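(* Let $n\geq 2$ be an integer. The subgraph of $\mathcal{M}(K_{2n})$ induced by the vertices with type $(n)$ is isomorphic to the signed reversal graph $\mathrm{SR}_{n-1}$.
   Context: $K_{2n}$ is the complete graph on the $2n$ vertices $0^{+},0^{-},1^{+},1^{-},\dots,(n-1)^{+},(n-1)^{-}$. The flip graph $\mathcal{M}(K_{2n})$ is the graph whose vertices are the perfect matchings of $K_{2n}$, where two perfect matchings are adjacent if their symmetric difference (as edge sets) is a cycle of length $4$. The identity perfect matching is $M_0=\{\{0^{+},0^{-}\},\dots,\{(n-1)^{+},(n-1)^{-}\}\}$. For a perfect matching $M$, the multigraph union $M_0\cup M$ is a disjoint union of cycles of even lengths $2\lambda_1\geq\cdots\geq 2\lambda_k$ (an edge lying in both $M_0$ and $M$ gives a cycle of length $2$); the partition $(\lambda_1,\dots,\lambda_k)$ of $n$ is called the type of $M$. So $M$ has type $(n)$ when $M_0\cup M$ is a single cycle of length $2n$. For $k\geq 1$, a signed permutation of degree $k$ is a $k$-tuple $(\sigma_1,\dots,\sigma_k)$ of integers such that $(|\sigma_1|,\dots,|\sigma_k|)$ is a permutation of $\{1,\dots,k\}$. The signed reversal graph $\mathrm{SR}_k$ is the graph whose vertices are the signed permutations of degree $k$, where $\sigma=(\sigma_1,\dots,\sigma_k)$ and $\tau=(\tau_1,\dots,\tau_k)$ are adjacent if there exist $1\leq i\leq j\leq k$ such that $(\tau_1,\dots,\tau_k)=(\sigma_1,\dots,\sigma_{i-1},-\sigma_j,-\sigma_{j-1},\dots,-\sigma_i,\sigma_{j+1},\dots,\sigma_k)$.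 *)

theory Defs
  imports
    "Graph_Theory.Graph_Theory"
    "HOL-Library.Multiset"
    "HOL-Combinatorics.Multiset_Permutations"
begin

text \<open>
  Simple graphs that are compared up to isomorphism are symmetric loop-free pair digraphs
  (locale \<open>pair_graph\<close> of \<open>Graph_Theory\<close>), each edge \<open>uv\<close> being
  the two arcs \<open>(u,v)\<close> and \<open>(v,u)\<close>. The edges of \<open>K\<^bsub>2n\<^esub>\<close>,
  of which perfect matchings consist, are two-element sets.
\<close>

text \<open>The vertex \<open>i\<^sup>+\<close> is \<open>(i, True)\<close>, and \<open>i\<^sup>-\<close> is \<open>(i, False)\<close>.\<close>

type_synonym vertex = "nat \<times> bool"

definition K_verts :: "nat \<Rightarrow> vertex set" where
  "K_verts n = {0..<n} \<times> UNIV"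

definition complete_edges :: "'a set \<Rightarrow> 'a set set" where
  "complete_edges V = {{u, v} | u v. u \<in> V \<and> v \<in> V \<and> u \<noteq> v}"

definition perfect_matching :: "'a set \<Rightarrow> 'a set set \<Rightarrow> 'a set set \<Rightarrow> bool" where
  "perfect_matching V E M \<longleftrightarrow> M \<subseteq> E \<and> (\<forall>v\<in>V. \<exists>!e. e \<in> M \<and> v \<in> e)"

text \<open>
  The edges of the cycle through \<open>v\<^sub>1, \<dots>, v\<^sub>l\<close> (distinct, \<open>l \<ge> 2\<close>) and back to
  \<open>v\<^sub>1\<close>, counted with multiplicity: for \<open>l = 2\<close> this is a doubled edge.
\<close>

definition cycle_edges :: "'a list \<Rightarrow> 'a set multiset" where
  "cycle_edges vs = mset (map2 (\<lambda>u v. {u, v}) vs (rotate1 vs))"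

definition flip_adjacent :: "'a set set \<Rightarrow> 'a set set \<Rightarrow> bool" where
  "flip_adjacent M N \<longleftrightarrow>
    (\<exists>vs. distinct vs \<and> length vs = 4 \<and> mset_set (sym_diff M N) = cycle_edges vs)"

definition flip_graph :: "'a set \<Rightarrow> 'a set set \<Rightarrow> 'a set set pair_pre_digraph" where
  "flip_graph V E =
    \<lparr> pverts = {M. perfect_matching V E M},
      parcs = {(M, N). perfect_matching V E M \<and> perfect_matching V E N \<and> flip_adjacent M N} \<rparr>"

definition flip_graph_K :: "nat \<Rightarrow> vertex set set pair_pre_digraph" where
  "flip_graph_K n = flip_graph (K_verts n) (complete_edges (K_verts n))"

definition id_matching :: "nat \<Rightarrow> vertex set set" where
  "id_matching n = (\<lambda>i. {(i, True), (i, False)}) ` {0..<n}"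

text \<open>
  \<open>has_type n M ps\<close>: the multigraph union of the identity matching and \<open>M\<close> is the
  disjoint union of cycles \<open>cs\<close> (given by their vertex sequences) whose lengths
  are twice the parts of \<open>ps\<close>, listed in weakly decreasing order.
\<close>

definition has_type :: "nat \<Rightarrow> vertex set set \<Rightarrow> nat list \<Rightarrow> bool" where
  "has_type n M ps \<longleftrightarrow>
    sorted_wrt (\<ge>) ps \<and> (\<forall>l\<in>set ps. l \<ge> 1) \<and>
    (\<exists>cs. map length cs = map ((*) 2) ps \<and>
      distinct (concat cs) \<and> set (concat cs) = K_verts n \<and>
      mset_set (id_matching n) + mset_set M = sum_list (map cycle_edges cs))"

definition signed_perms :: "nat \<Rightarrow> int list set" where
  "signed_perms k = {\<sigma>. map abs \<sigma> \<in> permutations_of_set {1..int k}}"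

text \<open>Positions \<open>i \<le> j\<close> are counted from \<open>1\<close>.\<close>

definition signed_reversal :: "nat \<Rightarrow> nat \<Rightarrow> int list \<Rightarrow> int list" where
  "signed_reversal i j \<sigma> =
    take (i - 1) \<sigma> @ map uminus (rev (drop (i - 1) (take j \<sigma>))) @ drop j \<sigma>"

definition SR :: "nat \<Rightarrow> int list pair_pre_digraph" where
  "SR k =
    \<lparr> pverts = signed_perms k,
      parcs = {(\<sigma>, \<tau>). \<sigma> \<in> signed_perms k \<and> \<tau> \<in> signed_perms k \<and>
        (\<exists>i j. 1 \<le> i \<and> i \<le> j \<and> j \<le> k \<and> \<tau> = signed_reversal i j \<sigma>)} \<rparr>"

lemma pair_graph_flip_graph_K: "pair_graph (flip_graph_K n)"
proof -
  have fin: "finite (complete_edges (K_verts n))"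
    by (rule finite_subset[of _ "Pow (K_verts n)"]) (auto simp: complete_edges_def K_verts_def)
  have finV: "finite {M. perfect_matching (K_verts n) (complete_edges (K_verts n)) M}"
    by (rule finite_subset[of _ "Pow (complete_edges (K_verts n))"])
      (use fin in \<open>auto simp: perfect_matching_def\<close>)
  have sym: "flip_adjacent M N \<Longrightarrow> flip_adjacent N M" for M N :: "vertex set set"
    unfolding flip_adjacent_def by (metis Un_commute)
  have irrefl: "\<not> flip_adjacent M M" for M :: "vertex set set"
  proof
    assume "flip_adjacent M M"
    then obtain vs :: "vertex list" where "length vs = 4" "{#} = cycle_edges vs"
      by (auto simp: flip_adjacent_def)
    then show False
      by (auto simp: cycle_edges_def)
  qed
  show ?thesis
  proof unfold_locales
    show "finite (parcs (flip_graph_K n))"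
      by (rule finite_subset[OF _ finite_cartesian_product[OF finV finV]])
        (auto simp: flip_graph_K_def flip_graph_def)
  qed (use finV sym irrefl in \<open>auto simp: flip_graph_K_def flip_graph_def symmetric_def sym_def\<close>)
qed

lemma signed_perms_iff:
  "\<sigma> \<in> signed_perms k \<longleftrightarrow> distinct (map abs \<sigma>) \<and> abs ` set \<sigma> = {1..int k}"
  by (auto simp: signed_perms_def permutations_of_set_def)

lemma length_signed_perm:
  assumes "\<sigma> \<in> signed_perms k"
  shows "length \<sigma> = k"
proof -
  have "length (map abs \<sigma>) = card (set (map abs \<sigma>))"
    using assms by (metis distinct_card signed_perms_iff)
  then show ?thesis
    using assms by (simp add: signed_perms_iff)
qed

lemma signed_reversal_involution:
  assumes "1 \<le> i" "i \<le> j" "j \<le> length \<sigma>"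
  shows "signed_reversal i j (signed_reversal i j \<sigma>) = \<sigma>"
proof -
  define a b c where "a = take (i - 1) \<sigma>" and "b = drop (i - 1) (take j \<sigma>)" and "c = drop j \<sigma>"
  have len: "length a = i - 1" "length b = j - (i - 1)"
    using assms by (auto simp: a_def b_def)
  have "i - 1 \<le> j"
    using assms by linarith
  then have "a = take (i - 1) (take j \<sigma>)"
    by (simp add: a_def min_absorb1)
  then have "\<sigma> = a @ b @ c"
    unfolding b_def c_def by (simp only: append_take_drop_id flip: append_assoc)
  moreover have "signed_reversal i j (a @ b @ c) = a @ map uminus (rev b) @ c" if
    "length b = j - (i - 1)" for b
    using len(1) that assms by (simp add: signed_reversal_def)
  ultimately show ?thesis
    using len(2) by (simp add: rev_map o_def)
qed

lemma signed_reversal_neq: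
  assumes "1 \<le> i" "i \<le> j" "j \<le> k" "\<sigma> \<in> signed_perms k"
  shows "signed_reversal i j \<sigma> \<noteq> \<sigma>"
proof
  have len: "length \<sigma> = k" using assms by (simp add: length_signed_perm)
  assume "signed_reversal i j \<sigma> = \<sigma>"
  then have "signed_reversal i j \<sigma> ! (i - 1) = \<sigma> ! (i - 1)" by simp
  moreover have "signed_reversal i j \<sigma> ! (i - 1) = - \<sigma> ! (j - 1)"
    using assms len by (simp add: signed_reversal_def nth_append rev_nth)
  ultimately have eq: "- \<sigma> ! (j - 1) = \<sigma> ! (i - 1)" by simp
  then have "\<bar>\<sigma> ! (i - 1)\<bar> = \<bar>\<sigma> ! (j - 1)\<bar>"
    by (metis abs_minus_cancel)
  moreover have "i - 1 < length \<sigma>" "j - 1 < length \<sigma>"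
    using assms len by auto
  ultimately have "map abs \<sigma> ! (i - 1) = map abs \<sigma> ! (j - 1)"
    by simp
  then have "i - 1 = j - 1"
    using assms len by (subst (asm) nth_eq_iff_index_eq) (auto simp: signed_perms_iff)
  with eq have "\<sigma> ! (i - 1) = 0" by simp
  moreover have "\<sigma> ! (i - 1) \<in> set \<sigma>" using assms len by simp
  ultimately have "0 \<in> abs ` set \<sigma>" by force
  then show False using assms by (simp add: signed_perms_iff)
qed

lemma pair_graph_SR: "pair_graph (SR k)"
proof -
  have "signed_perms k \<subseteq> {\<sigma>. set \<sigma> \<subseteq> {- int k..int k} \<and> length \<sigma> = k}"
  proof safe
    fix \<sigma> x assume "\<sigma> \<in> signed_perms k" "x \<in> set \<sigma>"
    then have "\<bar>x\<bar> \<in> {1..int k}" unfolding signed_perms_iff by blast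
    then show "x \<in> {- int k..int k}" by auto
  qed (rule length_signed_perm)
  then have fin: "finite (signed_perms k)"
    by (rule finite_subset) (simp add: finite_lists_length_eq)
  show ?thesis
  proof unfold_locales
    show "finite (parcs (SR k))"
      by (rule finite_subset[OF _ finite_cartesian_product[OF fin fin]]) (auto simp: SR_def)
    have "(\<tau>, \<sigma>) \<in> parcs (SR k)" if "(\<sigma>, \<tau>) \<in> parcs (SR k)" for \<sigma> \<tau>
    proof -
      from that obtain i j where ij: "1 \<le> i" "i \<le> j" "j \<le> k" "\<tau> = signed_reversal i j \<sigma>"
        and perms: "\<sigma> \<in> signed_perms k" "\<tau> \<in> signed_perms k"
        by (auto simp: SR_def)
      have "\<sigma> = signed_reversal i j \<tau>"
        using ij perms by (simp add: signed_reversal_involution length_signed_perm)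
      with ij(1-3) perms show ?thesis
        unfolding SR_def by auto
    qed
    then show "symmetric (SR k)"
      by (simp add: symmetric_def sym_def)
    show "fst e \<noteq> snd e" if "e \<in> parcs (SR k)" for e
    proof -
      from that obtain i j where "1 \<le> i" "i \<le> j" "j \<le> k" "snd e = signed_reversal i j (fst e)"
        "fst e \<in> signed_perms k"
        by (auto simp: SR_def)
      then show ?thesis
        using signed_reversal_neq by metis
    qed
  qed (use fin in \<open>auto simp: SR_def\<close>)
qed

end

theory Submission
  imports Defs
begin

text \<open>
  Write \<open>k = n - 1\<close>. If \<open>M\<close> has type \<open>(n)\<close>, the cycle \<open>M\<^sub>0 \<union> M\<close> alternates between edges of
  \<open>M\<^sub>0\<close> and edges of \<open>M\<close>. Start at \<open>0\<^sup>+\<close> and cross the edge \<open>0\<^sup>+0\<^sup>-\<close> first: the cycle then visits the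
  other pairs \<open>i\<^sup>+i\<^sup>-\<close> in some order, crossing each in one of its two directions. Recording a
  pair that is entered at \<open>i\<^sup>+\<close> as \<open>i\<close> and one that is entered at \<open>i\<^sup>-\<close> as \<open>- i\<close> gives a signed
  permutation \<open>\<sigma>\<close> of degree \<open>k\<close>. Conversely, \<open>\<sigma>\<close> gives the matching \<open>matching_of \<sigma>\<close>, whose edges
  link the exit vertex of each term of the closed walk \<open>0, \<sigma>\<^sub>1, \<dots>, \<sigma>\<^sub>k, 0\<close> to the entry vertex of the
  next one. This is the isomorphism.

  It is injective because a matching contains at most one edge at each exit vertex, so that it
  determines the walk term by term (\<open>links_determine_walk\<close>). It is onto because a longest walk along
  \<open>M\<close> that starts at \<open>0\<close> and repeats no pair can only close up at \<open>0\<close>, and the pairs that it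
  visits are then closed under \<open>M\<^sub>0\<close> and \<open>M\<close>, hence are all the pairs of the single cycle
  (\<open>matching_of_surj\<close>).

  For adjacency, note that walking through a segment of the walk backwards exchanges entries and
  exits, which is negation of the labels. So reversing a segment keeps its inner links and
  replaces only the two links at its ends, say \<open>pu\<close> and \<open>vq\<close>, by \<open>pv\<close> and \<open>uq\<close>: a flip. Conversely,
  a flip removes two links \<open>pu\<close> and \<open>vq\<close>, and there are just two other ways to match their ends. One of
  them is the reversal. The other, \<open>pq\<close> and \<open>uv\<close>, cuts the segment off into a cycle of its own:
  the walk from \<open>0\<close> would close up early, which cannot happen for a matching of type
  \<open>(n)\<close> (\<open>reversal_of_flip_adjacent\<close>).
\<close>

section \<open>Entry and exit vertices\<close>

text \<open>
  A positive label stands for crossing a pair from \<open>i\<^sup>+\<close> to \<open>i\<^sup>-\<close>, a negative one for the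
  opposite direction. The label \<open>0\<close> has no sign and counts as positive, which fixes the
  direction in which the cycle is traversed.
\<close>

definition entry :: "int \<Rightarrow> vertex" where
  "entry x = (nat \<bar>x\<bar>, 0 \<le> x)"

definition exit :: "int \<Rightarrow> vertex" where
  "exit x = (nat \<bar>x\<bar>, x < 0)"

lemma entry_eq_iff [simp]: "entry x = entry y \<longleftrightarrow> x = y"
  by (auto simp: entry_def)

lemma exit_eq_iff [simp]: "exit x = exit y \<longleftrightarrow> x = y"
  by (auto simp: exit_def)

lemma exit_eq_entry_iff [simp]: "exit x = entry y \<longleftrightarrow> y = - x \<and> x \<noteq> 0"
  by (auto simp: entry_def exit_def)

lemma entry_eq_exit_iff [simp]: "entry y = exit x \<longleftrightarrow> y = - x \<and> x \<noteq> 0"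
  by (auto simp: entry_def exit_def)

text \<open>
  Negating a nonzero label exchanges the two ends of its pair; this is why reversals come with signs.
\<close>

lemma entry_uminus: "x \<noteq> 0 \<Longrightarrow> entry (- x) = exit x"
  and exit_uminus: "x \<noteq> 0 \<Longrightarrow> exit (- x) = entry x"
  by (auto simp: entry_def exit_def)

lemma fst_entry [simp]: "fst (entry x) = nat \<bar>x\<bar>"
  and fst_exit [simp]: "fst (exit x) = nat \<bar>x\<bar>"
  by (auto simp: entry_def exit_def)

lemma vertex_cases: "fst v = nat \<bar>x\<bar> \<Longrightarrow> v = entry x \<or> v = exit x"
  by (cases v) (auto simp: entry_def exit_def)

lemma mem_K_verts_iff: "v \<in> K_verts n \<longleftrightarrow> fst v < n"
  by (cases v) (auto simp: K_verts_def)

section \<open>Links of a walk\<close>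

definition links :: "int list \<Rightarrow> vertex set list" where
  "links xs = map2 (\<lambda>x y. {exit x, entry y}) xs (tl xs)"

definition junction :: "int list \<Rightarrow> int list \<Rightarrow> vertex set" where
  "junction xs ys = {exit (last xs), entry (hd ys)}"

text \<open>
  The pair \<open>0\<close> occurs at both ends, so that the two links at it are treated like the others.
\<close>

definition matching_of :: "int list \<Rightarrow> vertex set set" where
  "matching_of \<sigma> = set (links (0 # \<sigma> @ [0]))"

lemma links_simps [simp]:
  "links [] = []" "links [x] = []"
  "links (x # y # zs) = {exit x, entry y} # links (y # zs)"
  by (simp_all add: links_def)

lemma links_append:
  assumes "xs \<noteq> []" "ys \<noteq> []"
  shows "links (xs @ ys) = links xs @ junction xs ys # links ys"
  using assms
proof (induction xs)
  case (Cons x xs)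
  show ?case
  proof (cases xs)
    case Nil
    with Cons.prems show ?thesis by (cases ys) (auto simp: junction_def)
  next
    case (Cons x' xs')
    with Cons.IH Cons.prems show ?thesis by (simp add: junction_def)
  qed
qed simp

text \<open>
  The walk backwards uses the same links: \<open>{exit (- y), entry (- x)}\<close> is \<open>{entry y, exit x}\<close>. The label \<open>0\<close>
  has to be excluded because it is its own negative.
\<close>

lemma links_map_uminus_rev:
  "0 \<notin> set xs \<Longrightarrow> set (links (map uminus (rev xs))) = set (links xs)"
proof (induction xs)
  case (Cons x xs)
  show ?case
  proof (cases xs)
    case (Cons y ys)
    have "set (links (map uminus (rev (x # xs)))) = 
        insert (junction (map uminus (rev xs)) [- x]) (set (links (map uminus (rev xs))))"
      using Cons links_append[of "map uminus (rev xs)" "[- x]"] by simp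
    also have "junction (map uminus (rev xs)) [- x] = {exit x, entry y}"
      using Cons Cons.prems by (auto simp: junction_def entry_uminus exit_uminus)
    finally show ?thesis
      using Cons.IH Cons.prems Cons by auto
  qed simp
qed simp

lemma link_split:
  assumes "e \<in> set (links l)"
  obtains xs ys where "xs \<noteq> []" "ys \<noteq> []" "l = xs @ ys" "e = junction xs ys"
  using assms
proof (induction l arbitrary: thesis)
  case (Cons x l)
  show ?case
  proof (cases l)
    case Nil
    with Cons.prems show ?thesis by simp
  next
    case l: (Cons y l')
    show ?thesis
    proof (cases "e = {exit x, entry y}")
      case True
      with l show ?thesis by (intro Cons.prems(1)[of "[x]" l]) (auto simp: junction_def)
    next
      case False
      with Cons.prems(2) l have "e \<in> set (links l)" by simp
      then obtain xs ys where "xs \<noteq> []" "ys \<noteq> []" "l = xs @ ys" "e = junction xs ys"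
        using Cons.IH by blast
      then show ?thesis by (intro Cons.prems(1)[of "x # xs" ys]) (auto simp: junction_def)
    qed
  qed
qed simp

text \<open>
  Any two links cut the walk into three segments. The order of the two along the walk is not
  known, hence the disjunction.
\<close>

lemma two_links_split:
  assumes "e1 \<in> set (links l)" "e2 \<in> set (links l)" "e1 \<noteq> e2"
  obtains xs ys zs where "xs \<noteq> []" "ys \<noteq> []" "zs \<noteq> []" "l = xs @ ys @ zs"
    "e1 = junction xs ys \<and> e2 = junction ys zs \<or> e2 = junction xs ys \<and> e1 = junction ys zs"
proof -
  obtain xs ys where *: "xs \<noteq> []" "ys \<noteq> []" "l = xs @ ys" "e1 = junction xs ys"
    using assms(1) by (rule link_split)
  then consider "e2 \<in> set (links xs)" | "e2 \<in> set (links ys)"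
    using assms(2,3) by (auto simp: links_append)
  then show ?thesis
  proof cases
    case 1
    then obtain us vs where "us \<noteq> []" "vs \<noteq> []" "xs = us @ vs" "e2 = junction us vs"
      by (rule link_split)
    with * show ?thesis by (intro that[of us vs ys]) (auto simp: junction_def)
  next
    case 2
    then obtain us vs where "us \<noteq> []" "vs \<noteq> []" "ys = us @ vs" "e2 = junction us vs"
      by (rule link_split)
    with * show ?thesis by (intro that[of xs us vs]) (auto simp: junction_def)
  qed
qed

lemma link_from:
  assumes "x \<in> set (butlast l)"
  obtains y where "y \<in> set (tl l)" "{exit x, entry y} \<in> set (links l)"
proof -
  from assms obtain i where i: "i < length l - 1" "x = l ! i"
    by (auto simp: in_set_conv_nth nth_butlast)
  have "(l ! i, tl l ! i) \<in> set (zip l (tl l))"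
    using i by (auto simp: set_zip)
  then show ?thesis
    using i that[of "tl l ! i"] by (force simp: links_def)
qed

lemma link_into:
  assumes "y \<in> set (tl l)"
  obtains x where "x \<in> set (butlast l)" "{exit x, entry y} \<in> set (links l)"
proof -
  from assms obtain i where i: "i < length l - 1" "y = tl l ! i"
    by (auto simp: in_set_conv_nth)
  have "(l ! i, tl l ! i) \<in> set (zip l (tl l))"
    using i by (auto simp: set_zip)
  moreover have "l ! i \<in> set (butlast l)"
    using i by (metis length_butlast nth_butlast nth_mem)
  ultimately show ?thesis
    using i that[of "l ! i"] by (force simp: links_def)
qed

lemma zip_distinct_left:
  "\<lbrakk>distinct xs; (x, y) \<in> set (zip xs ys); (x, y') \<in> set (zip xs ys)\<rbrakk> \<Longrightarrow> y = y'"
  by (auto simp: in_set_zip nth_eq_iff_index_eq)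

lemma zip_distinct_right:
  "\<lbrakk>distinct ys; (x, y) \<in> set (zip xs ys); (x', y) \<in> set (zip xs ys)\<rbrakk> \<Longrightarrow> x = x'"
  by (auto simp: in_set_zip nth_eq_iff_index_eq)

section \<open>Perfect matchings and flips\<close>

abbreviation matching :: "'a set \<Rightarrow> 'a set set \<Rightarrow> bool" where
  "matching V \<equiv> perfect_matching V (complete_edges V)"

lemma matching_edgeE:
  assumes "matching V M" "e \<in> M"
  obtains u v where "e = {u, v}" "u \<in> V" "v \<in> V" "u \<noteq> v"
  using assms by (auto simp: perfect_matching_def complete_edges_def)

lemma matching_unique:
  assumes "matching V M" "e \<in> M" "e' \<in> M" "v \<in> e" "v \<in> e'"
  shows "e = e'"
proof -
  from assms have "v \<in> V" by (auto elim: matching_edgeE)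
  with assms show ?thesis unfolding perfect_matching_def by blast
qed

lemma matching_partner_unique:
  assumes "matching V M" "{u, v} \<in> M" "{u, w} \<in> M"
  shows "v = w"
  using matching_unique[OF assms, of u] by (auto simp: doubleton_eq_iff)

lemma matching_edge_neq: "matching V M \<Longrightarrow> {u, v} \<in> M \<Longrightarrow> u \<noteq> v"
  by (auto elim!: matching_edgeE simp: doubleton_eq_iff)

lemma matching_subset_eq:
  assumes "matching V M" "matching V N" "M \<subseteq> N"
  shows "M = N"
proof
  show "N \<subseteq> M"
  proof
    fix e assume e: "e \<in> N"
    with assms(2) obtain v where v: "v \<in> e" "v \<in> V" by (blast elim: matching_edgeE)
    with assms(1) obtain e' where "e' \<in> M" "v \<in> e'" unfolding perfect_matching_def by blast
    with assms e v show "e \<in> M" by (metis matching_unique subsetD)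
  qed
qed fact

lemma finite_K: "finite (K_verts n)"
  by (simp add: K_verts_def)

lemma finite_matching:
  assumes "matching V M" "finite V"
  shows "finite M"
  by (rule finite_subset[of _ "Pow V"]) (use assms in \<open>auto elim: matching_edgeE\<close>)

lemma sym_diff_exchange:
  assumes "p \<in> A" "r \<in> A" "q \<notin> A" "s \<notin> A"
  shows "sym_diff A (A - {p, r} \<union> {q, s}) = {p, q, r, s}"
  using assms by auto

text \<open>
  Consecutive edges of the 4-cycle share a vertex, so they cannot lie in the same matching: the
  edges alternate between \<open>M\<close> and \<open>N\<close>, and the flip exchanges two opposite edges for the
  other two.
\<close>

lemma matching_flip_adjacent_iff:
  assumes "matching V M" "matching V N" "finite V"
  shows "flip_adjacent M N \<longleftrightarrow> (\<exists>a b c d. distinct [a, b, c, d] \<and> {a, b} \<in> M \<and> {c, d} \<in> M \<and>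
    N = M - {{a, b}, {c, d}} \<union> {{b, c}, {d, a}})"
proof
  assume "flip_adjacent M N"
  then obtain vs where vs: "distinct vs" "length vs = 4"
    "mset_set (sym_diff M N) = cycle_edges vs"
    by (auto simp: flip_adjacent_def)
  from vs(2) obtain a b c d where abcd: "vs = [a, b, c, d]"
    by (auto simp: length_Suc_conv numeral_eq_Suc)
  have "finite (sym_diff M N)"
    using assms finite_matching by blast
  then have "sym_diff M N = set_mset (cycle_edges vs)"
    using vs(3) by (metis finite_set_mset_mset_set)
  then have diff: "sym_diff M N = {{a, b}, {b, c}, {c, d}, {d, a}}"
    by (auto simp: cycle_edges_def abcd)
  have dist: "distinct [a, b, c, d]" using vs abcd by simp
  note uniq = matching_partner_unique[OF assms(1)] matching_partner_unique[OF assms(2)]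
  show "\<exists>a b c d. distinct [a, b, c, d] \<and> {a, b} \<in> M \<and> {c, d} \<in> M \<and>
    N = M - {{a, b}, {c, d}} \<union> {{b, c}, {d, a}}"
  proof -
    have key: "\<exists>a b c d. distinct [a, b, c, d] \<and> {a, b} \<in> M \<and> {c, d} \<in> M \<and>
        N = M - {{a, b}, {c, d}} \<union> {{b, c}, {d, a}}"
      if diff: "sym_diff M N = {{a, b}, {b, c}, {c, d}, {d, a}}"
        and dist: "distinct [a, b, c, d]" and ab: "{a, b} \<in> M" for a b c d
    proof -
      \<comment> \<open>Membership propagates around the cycle, one edge at a time.\<close>
      have "{b, c} \<notin> M" using uniq(1)[of b a c] ab dist by (auto simp: insert_commute)
      then have bc: "{b, c} \<in> N - M" using diff by auto
      have "{c, d} \<notin> N" using uniq(2)[of c b d] bc dist by (auto simp: insert_commute)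
      then have cd: "{c, d} \<in> M - N" using diff by auto
      have "{d, a} \<notin> M" using uniq(1)[of d c a] cd dist by (auto simp: insert_commute)
      then have da: "{d, a} \<in> N - M" using diff by auto
      have "{a, b} \<notin> N" using uniq(2)[of a b d] da dist by (auto simp: insert_commute)
      then have "{a, b} \<in> M - N" using ab by auto
      with bc cd da diff have "N = M - {{a, b}, {c, d}} \<union> {{b, c}, {d, a}}" by blast
      with ab cd dist show ?thesis by blast
    qed
    show ?thesis
    proof (cases "{a, b} \<in> M")
      case True
      with diff dist show ?thesis by (intro key[of a b c d])
    next
      case False
      \<comment> \<open>Then \<open>{b, c}\<close> is in \<open>M\<close>, and the list of the vertices can be rotated by one.\<close>
      then have "{a, b} \<in> N" using diff by auto
      then have "{b, c} \<notin> N" using uniq(2)[of b a c] dist by (auto simp: insert_commute)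
      then have "{b, c} \<in> M" using diff by auto
      moreover have "sym_diff M N = {{b, c}, {c, d}, {d, a}, {a, b}}" using diff by auto
      moreover have "distinct [b, c, d, a]" using dist by auto
      ultimately show ?thesis by (intro key[of b c d a])
    qed
  qed
next
  assume "\<exists>a b c d. distinct [a, b, c, d] \<and> {a, b} \<in> M \<and> {c, d} \<in> M \<and>
    N = M - {{a, b}, {c, d}} \<union> {{b, c}, {d, a}}"
  then obtain a b c d where *: "distinct [a, b, c, d]" "{a, b} \<in> M" "{c, d} \<in> M"
    "N = M - {{a, b}, {c, d}} \<union> {{b, c}, {d, a}}"
    by blast
  note uniq = matching_partner_unique[OF assms(1)]
  have "{b, c} \<notin> M" using uniq[of b a c] * by (auto simp: insert_commute)
  moreover have "{d, a} \<notin> M" using uniq[of d c a] * by (auto simp: insert_commute)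
  moreover have neq: "{a, b} \<noteq> {b, c}" "{a, b} \<noteq> {c, d}" "{a, b} \<noteq> {d, a}"
    "{b, c} \<noteq> {c, d}" "{b, c} \<noteq> {d, a}" "{c, d} \<noteq> {d, a}"
    using *(1) by (auto simp: doubleton_eq_iff)
  ultimately have "sym_diff M N = {{a, b}, {b, c}, {c, d}, {d, a}}"
    unfolding *(4) by (intro sym_diff_exchange *(2,3))
  then have "mset_set (sym_diff M N) = cycle_edges [a, b, c, d]"
    using neq by (simp add: cycle_edges_def)
  then show "flip_adjacent M N"
    using *(1) unfolding flip_adjacent_def by (intro exI[of _ "[a, b, c, d]"]) auto
qed

section \<open>From signed permutations to matchings of full type\<close>

lemma signed_perms_iff_Cons_0:
  "\<sigma> \<in> signed_perms k \<longleftrightarrow>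
    distinct (map abs (0 # \<sigma>)) \<and> abs ` set (0 # \<sigma>) = {0..int k}"
proof (cases "0 \<in> set \<sigma>")
  case True
  then have "0 \<in> abs ` set \<sigma>" by force
  then have "abs ` set \<sigma> \<noteq> {1..int k}"
    by (metis atLeastAtMost_iff not_one_le_zero)
  with True show ?thesis by (simp add: signed_perms_iff)
next
  case False
  then have 0: "0 \<notin> abs ` set \<sigma>" by auto
  moreover have "{0..int k} = insert 0 {1..int k}" "0 \<notin> {1..int k}" by auto
  ultimately have eq: "abs ` set (0 # \<sigma>) = {0..int k} \<longleftrightarrow> abs ` set \<sigma> = {1..int k}"
    by (simp add: insert_ident)
  show ?thesis
    by (simp only: signed_perms_iff eq list.map distinct.simps set_map abs_zero 0 simp_thms)
qed

lemma signed_perm_0_notin: "\<sigma> \<in> signed_perms k \<Longrightarrow> 0 \<notin> set \<sigma>"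
  by (auto simp: signed_perms_iff_Cons_0)

lemma signed_permD:
  assumes "\<sigma> \<in> signed_perms k"
  shows "distinct (0 # \<sigma>)"
    and "\<And>x y. x \<in> set (0 # \<sigma>) \<Longrightarrow> y \<in> set (0 # \<sigma>) \<Longrightarrow> \<bar>x\<bar> = \<bar>y\<bar> \<Longrightarrow> x = y"
    and "\<And>x. x \<in> set (0 # \<sigma>) \<Longrightarrow> \<bar>x\<bar> < int (Suc k)"
    and "\<And>v. v \<in> K_verts (Suc k) \<Longrightarrow> \<exists>x\<in>set (0 # \<sigma>). v = entry x \<or> v = exit x"
proof -
  from assms have d: "distinct (map abs (0 # \<sigma>))" and s: "abs ` set (0 # \<sigma>) = {0..int k}"
    by (simp_all only: signed_perms_iff_Cons_0)
  show "distinct (0 # \<sigma>)"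
    using d unfolding distinct_map by blast
  show "x = y" if "x \<in> set (0 # \<sigma>)" "y \<in> set (0 # \<sigma>)" "\<bar>x\<bar> = \<bar>y\<bar>" for x y
    using d that unfolding distinct_map inj_on_def by blast
  show "\<bar>x\<bar> < int (Suc k)" if "x \<in> set (0 # \<sigma>)" for x
  proof -
    from that have "\<bar>x\<bar> \<in> abs ` set (0 # \<sigma>)" by (rule imageI)
    then show ?thesis unfolding s by simp
  qed
  show "\<exists>x\<in>set (0 # \<sigma>). v = entry x \<or> v = exit x" if "v \<in> K_verts (Suc k)" for v
  proof -
    from that have "int (fst v) \<in> abs ` set (0 # \<sigma>)"
      unfolding s by (simp add: mem_K_verts_iff)
    then obtain x where "x \<in> set (0 # \<sigma>)" "int (fst v) = \<bar>x\<bar>" by blast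
    then show ?thesis
      by (intro bexI[of _ x] vertex_cases) auto
  qed
qed

context
  fixes \<sigma> :: "int list" and k :: nat
  assumes \<sigma>: "\<sigma> \<in> signed_perms k"
begin

text \<open>
  A common vertex is an exit of both links or an entry of both, because a vertex that is both an exit and
  an entry would give two terms of the walk with opposite nonzero labels.
\<close>

lemma links_overlap:
  assumes "(x, y) \<in> set (zip (0 # \<sigma>) (\<sigma> @ [0]))" "(x', y') \<in> set (zip (0 # \<sigma>) (\<sigma> @ [0]))"
    and "v \<in> {exit x, entry y}" "v \<in> {exit x', entry y'}"
  shows "x = x' \<and> y = y'"
proof -
  note perm = signed_permD[OF \<sigma>]
  have mem: "x \<in> set (0 # \<sigma>)" "x' \<in> set (0 # \<sigma>)" "y \<in> set (0 # \<sigma>)" "y' \<in> set (0 # \<sigma>)"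
    using assms(1,2) by (auto dest: set_zip_leftD set_zip_rightD)
  have "distinct (\<sigma> @ [0])" using perm(1) by simp
  have fwd: "y = y'" if "x = x'"
    using assms(1,2) that perm(1) by (blast intro: zip_distinct_left)
  have bwd: "x = x'" if "y = y'"
    using assms(1,2) that \<open>distinct (\<sigma> @ [0])\<close> by (blast intro: zip_distinct_right)
  have "\<not> (exit u = entry w)" if "u \<in> set (0 # \<sigma>)" "w \<in> set (0 # \<sigma>)" for u w
    using perm(2)[OF that] by auto
  then have "x = x' \<or> y = y'"
    using assms(3,4) mem by (metis insertE entry_eq_iff exit_eq_iff singletonD)
  with fwd bwd show ?thesis by blast
qed

lemma distinct_links: "distinct (links (0 # \<sigma> @ [0]))"
proof -
  have "distinct (zip (0 # \<sigma>) (\<sigma> @ [0]))"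
    by (rule distinct_zipI1[OF signed_permD(1)[OF \<sigma>]])
  moreover have "inj_on (\<lambda>(x, y). {exit x, entry y}) (set (zip (0 # \<sigma>) (\<sigma> @ [0])))"
  proof (rule inj_onI, clarify)
    fix x y x' y'
    assume "(x, y) \<in> set (zip (0 # \<sigma>) (\<sigma> @ [0]))" "(x', y') \<in> set (zip (0 # \<sigma>) (\<sigma> @ [0]))"
      and eq: "{exit x, entry y} = {exit x', entry y'}"
    moreover have "exit x \<in> {exit x', entry y'}" unfolding eq[symmetric] by simp
    ultimately show "x = x' \<and> y = y'" using links_overlap[of x y x' y' "exit x"] by simp
  qed
  moreover have "links (0 # \<sigma> @ [0]) = map (\<lambda>(x, y). {exit x, entry y}) (zip (0 # \<sigma>) (\<sigma> @ [0]))"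
    using zip_append1[of "0 # \<sigma>" "[0]" "\<sigma> @ [0]"] by (simp add: links_def)
  ultimately show ?thesis by (simp add: distinct_map)
qed


lemma links_Cons_0: "links (0 # \<sigma> @ [0]) = map2 (\<lambda>x y. {exit x, entry y}) (0 # \<sigma>) (\<sigma> @ [0])"
  using zip_append1[of "0 # \<sigma>" "[0]" "\<sigma> @ [0]"] by (simp add: links_def)

lemma matching_matching_of: "matching (K_verts (Suc k)) (matching_of \<sigma>)"
  unfolding perfect_matching_def
proof (intro conjI ballI subsetI)
  note perm = signed_permD[OF \<sigma>]
  have edge: "\<exists>x y. (x, y) \<in> set (zip (0 # \<sigma>) (\<sigma> @ [0])) \<and> e = {exit x, entry y}"
    if "e \<in> matching_of \<sigma>" for e
    using that by (force simp: matching_of_def links_Cons_0)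
  show "e \<in> complete_edges (K_verts (Suc k))" if e: "e \<in> matching_of \<sigma>" for e
  proof -
    from edge[OF e] obtain x y where xy: "(x, y) \<in> set (zip (0 # \<sigma>) (\<sigma> @ [0]))"
      "e = {exit x, entry y}" by blast
    then have mem: "x \<in> set (0 # \<sigma>)" "y \<in> set (0 # \<sigma>)"
      by (auto dest: set_zip_leftD set_zip_rightD)
    have "nat \<bar>x\<bar> < Suc k" "nat \<bar>y\<bar> < Suc k"
      using perm(3)[OF mem(1)] perm(3)[OF mem(2)] by auto
    moreover have "exit x \<noteq> entry y" using perm(2)[OF mem] by auto
    ultimately show ?thesis
      unfolding complete_edges_def xy(2)
      by (intro CollectI exI[of _ "exit x"] exI[of _ "entry y"]) (simp add: mem_K_verts_iff)
  qed
  fix v assume "v \<in> K_verts (Suc k)"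
  then obtain x where x: "x \<in> set (0 # \<sigma>)" "v = entry x \<or> v = exit x"
    using perm(4) by blast
  have "\<exists>e\<in>matching_of \<sigma>. v \<in> e"
  proof -
    have "x \<in> set (butlast (0 # \<sigma> @ [0]))" "x \<in> set (tl (0 # \<sigma> @ [0]))"
      using x(1) by (auto simp: butlast_append)
    then show ?thesis
      using x(2) unfolding matching_of_def
      by (metis insertI1 insertI2 link_from link_into)
  qed
  moreover have "e = e'" if e: "e \<in> matching_of \<sigma>" "e' \<in> matching_of \<sigma>" "v \<in> e" "v \<in> e'" for e e'
    using edge[OF e(1)] edge[OF e(2)] e(3,4) links_overlap by blast
  ultimately show "\<exists>!e. e \<in> matching_of \<sigma> \<and> v \<in> e" by blast
qed

end

text \<open>
  The vertex sequence of the cycle \<open>M\<^sub>0 \<union> matching_of \<sigma>\<close>, for \<open>xs = 0 # \<sigma>\<close>.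
\<close>

definition hamilton_walk :: "int list \<Rightarrow> vertex list" where
  "hamilton_walk xs = concat (map (\<lambda>x. [entry x, exit x]) xs)"

lemma hamilton_walk_simps [simp]:
  "hamilton_walk [] = []"
  "hamilton_walk (x # xs) = entry x # exit x # hamilton_walk xs"
  by (simp_all add: hamilton_walk_def)

lemma length_hamilton_walk: "length (hamilton_walk xs) = 2 * length xs"
  by (induction xs) auto

lemma set_hamilton_walk: "set (hamilton_walk xs) = entry ` set xs \<union> exit ` set xs"
  by (induction xs) auto

lemma distinct_hamilton_walk: "distinct (map abs xs) \<Longrightarrow> distinct (hamilton_walk xs)"
  by (induction xs) (auto simp: set_hamilton_walk rev_image_eqI)

text \<open>
  The walk is closed up by a vertex \<open>entry z\<close> with \<open>z\<close> arbitrary, so that induction on \<open>xs\<close> is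
  possible; the cycle is the case where \<open>z\<close> is the first label.
\<close>

lemma hamilton_walk_edges:
  assumes "xs \<noteq> []"
  shows "mset (map2 (\<lambda>u v. {u, v}) (hamilton_walk xs) (tl (hamilton_walk xs) @ [entry z])) =
    mset (map (\<lambda>x. {entry x, exit x}) xs) + mset (links (xs @ [z]))"
  using assms
proof (induction xs)
  case (Cons x xs)
  then show ?case by (cases xs) auto
qed simp

lemma cycle_edges_hamilton_walk:
  "cycle_edges (hamilton_walk (x # xs)) =
    mset (map (\<lambda>x. {entry x, exit x}) (x # xs)) + mset (links (x # xs @ [x]))"
  using hamilton_walk_edges[of "x # xs" x] by (simp add: cycle_edges_def)

lemma id_matching_eq:
  assumes "\<sigma> \<in> signed_perms k"
  shows "mset_set (id_matching (Suc k)) = mset (map (\<lambda>x. {entry x, exit x}) (0 # \<sigma>))"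
proof -
  have pair: "{entry x, exit x} = {(nat \<bar>x\<bar>, True), (nat \<bar>x\<bar>, False)}" for x
    by (auto simp: entry_def exit_def)
  have "id_matching (Suc k) = (\<lambda>x. {(nat x, True), (nat x, False)}) ` {0..int k}"
  proof -
    have "{0..<Suc k} = nat ` {0..int k}"
      by (auto simp: image_def intro!: bexI[of _ "int _"])
    then show ?thesis by (simp add: id_matching_def image_image)
  qed
  also have "\<dots> = (\<lambda>x. {(nat x, True), (nat x, False)}) ` abs ` set (0 # \<sigma>)"
    using assms by (simp only: signed_perms_iff_Cons_0)
  also have "\<dots> = set (map (\<lambda>x. {entry x, exit x}) (0 # \<sigma>))"
    by (simp only: pair image_image set_map)
  finally have eq: "id_matching (Suc k) = set (map (\<lambda>x. {entry x, exit x}) (0 # \<sigma>))" .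
  have "inj_on (\<lambda>x. {entry x, exit x}) (set (0 # \<sigma>))"
  proof (rule inj_onI)
    fix x y assume "x \<in> set (0 # \<sigma>)" "y \<in> set (0 # \<sigma>)" "{entry x, exit x} = {entry y, exit y}"
    moreover from this(3) have "nat \<bar>x\<bar> = nat \<bar>y\<bar>" unfolding pair by (auto simp: doubleton_eq_iff)
    ultimately show "x = y" using signed_permD(2)[OF assms, of x y] by simp
  qed
  then have "distinct (map (\<lambda>x. {entry x, exit x}) (0 # \<sigma>))"
    using signed_permD(1)[OF assms] by (simp only: distinct_map simp_thms)
  then show ?thesis unfolding eq by (rule mset_set_set)
qed

lemma has_type_matching_of:
  assumes "\<sigma> \<in> signed_perms k"
  shows "has_type (Suc k) (matching_of \<sigma>) [Suc k]"
proof -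
  note perm = signed_permD[OF assms]
  let ?c = "hamilton_walk (0 # \<sigma>)"
  have "length ?c = 2 * Suc k"
    using length_signed_perm[OF assms] by (simp add: length_hamilton_walk)
  moreover have "distinct ?c"
    using assms by (intro distinct_hamilton_walk) (simp only: signed_perms_iff_Cons_0)
  moreover have "set ?c = K_verts (Suc k)"
  proof
    show "K_verts (Suc k) \<subseteq> set ?c"
      using perm(4) unfolding set_hamilton_walk by blast
    show "set ?c \<subseteq> K_verts (Suc k)"
    proof
      fix v assume "v \<in> set ?c"
      then obtain x where "x \<in> set (0 # \<sigma>)" "v = entry x \<or> v = exit x"
        unfolding set_hamilton_walk by blast
      with perm(3)[OF this(1)] show "v \<in> K_verts (Suc k)"
        by (auto simp: mem_K_verts_iff)
    qed
  qed
  moreover have "mset_set (id_matching (Suc k)) + mset_set (matching_of \<sigma>) = cycle_edges ?c"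
    unfolding id_matching_eq[OF assms] matching_of_def cycle_edges_hamilton_walk
    using distinct_links[OF assms] by (simp add: mset_set_set)
  ultimately show ?thesis
    unfolding has_type_def by (intro conjI exI[of _ "[?c]"]) auto
qed

section \<open>Matchings of full type determine their walk\<close>

text \<open>
  Each link is forced by the exit vertex that it starts from, and both walks stop at their first
  return to \<open>0\<close>. So one walk cannot be shorter than the other either; this is how flips that
  split the cycle are excluded.
\<close>

lemma links_determine_walk:
  assumes "matching V M" "0 \<notin> set xs" "0 \<notin> set ys"
    and "set (links (z # xs @ [0])) \<subseteq> M" "set (links (z # ys @ [0])) \<subseteq> M"
  shows "xs = ys"
  using assms(2-)
proof (induction xs arbitrary: z ys)
  case Nil
  show ?case
  proof (cases ys)
    case (Cons y ys')
    with Nil have "entry 0 = entry y"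
      by (intro matching_partner_unique[OF assms(1), of "exit z"]) auto
    with Nil Cons show ?thesis by simp
  qed simp
next
  case (Cons x xs)
  show ?case
  proof (cases ys)
    case Nil
    with Cons.prems have "entry 0 = entry x"
      by (intro matching_partner_unique[OF assms(1), of "exit z"]) auto
    with Cons.prems show ?thesis by simp
  next
    case ys: (Cons y ys')
    with Cons.prems have "entry x = entry y"
      by (intro matching_partner_unique[OF assms(1), of "exit z"]) auto
    with Cons.prems ys Cons.IH[of ys' x] show ?thesis by simp
  qed
qed

lemma matching_of_determines:
  assumes "\<sigma> \<in> signed_perms k" "0 \<notin> set xs" "set (links (0 # xs @ [0])) \<subseteq> matching_of \<sigma>"
  shows "xs = \<sigma>"
  by (rule links_determine_walk[OF matching_matching_of[OF assms(1)], of _ _ 0])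
    (use assms signed_perm_0_notin in \<open>auto simp: matching_of_def\<close>)

lemma inj_on_matching_of: "inj_on matching_of (signed_perms k)"
proof (rule inj_onI)
  fix \<sigma> \<tau> assume *: "\<sigma> \<in> signed_perms k" "\<tau> \<in> signed_perms k" "matching_of \<sigma> = matching_of \<tau>"
  show "\<sigma> = \<tau>"
    by (rule matching_of_determines[OF *(2)])
      (use * signed_perm_0_notin in \<open>auto simp: matching_of_def\<close>)
qed

text \<open>
  Used for the vertex sequence of the cycle \<open>M\<^sub>0 \<union> M\<close>: a set of vertices that is closed under the edges of
  \<open>M\<^sub>0\<close> and \<open>M\<close> is everything as soon as it is nonempty.
\<close>

lemma list_closed_set:
  assumes "\<And>i. Suc i < length c \<Longrightarrow> c ! i \<in> S \<longleftrightarrow> c ! Suc i \<in> S" "v \<in> set c" "v \<in> S"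
  shows "set c \<subseteq> S"
proof -
  have all: "i < length c \<Longrightarrow> c ! i \<in> S \<longleftrightarrow> c ! 0 \<in> S" for i
    by (induction i) (use assms(1) in auto)
  with assms(2,3) show ?thesis by (metis in_set_conv_nth subsetI)
qed

lemma consecutive_in_cycle_edges:
  assumes "Suc i < length c"
  shows "{c ! i, c ! Suc i} \<in># cycle_edges c"
proof -
  have "(c ! i, rotate1 c ! i) \<in> set (zip c (rotate1 c))"
    using assms by (auto simp: set_zip)
  moreover have "rotate1 c ! i = c ! Suc i"
    using assms by (simp add: nth_rotate1)
  ultimately show ?thesis by (force simp: cycle_edges_def)
qed

text \<open>
  A walk that cannot be extended along \<open>M\<close> without repeating a pair has to return to \<open>0\<close>. The
  single cycle \<open>M\<^sub>0 \<union> M\<close> then makes it visit every pair, since none of its edges leaves the set of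
  the visited pairs.
\<close>

lemma matching_of_surj:
  assumes M: "matching (K_verts (Suc k)) M" and type: "has_type (Suc k) M [Suc k]"
  shows "M \<in> matching_of ` signed_perms k"
proof -
  let ?V = "K_verts (Suc k)"
  from type obtain c where c: "set c = ?V"
    "mset_set (id_matching (Suc k)) + mset_set M = cycle_edges c"
    by (auto simp: has_type_def map_eq_Cons_conv)
  have "finite ?V" by (simp add: K_verts_def)
  with M have "finite M" by (rule finite_matching)
  moreover have "finite (id_matching (Suc k))" by (simp add: id_matching_def)
  ultimately have cyc: "set_mset (cycle_edges c) = id_matching (Suc k) \<union> M"
    by (simp flip: c(2))
  define path where "path xs \<longleftrightarrow> distinct (map abs (0 # xs)) \<and>
    abs ` set (0 # xs) \<subseteq> {0..int k} \<and> set (links (0 # xs)) \<subseteq> M" for xs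
  have "path []" by (simp add: path_def)
  moreover have "length xs < Suc k" if "path xs" for xs
  proof -
    from that have "card (set (map abs (0 # xs))) = Suc (length xs)"
      unfolding path_def by (metis distinct_card length_Cons length_map)
    moreover have "card (set (map abs (0 # xs))) \<le> card {0..int k}"
      using that by (intro card_mono) (simp_all add: path_def)
    ultimately show ?thesis by simp
  qed
  ultimately obtain xs where xs: "path xs" and max: "\<And>ys. path ys \<Longrightarrow> length ys \<le> length xs"
    using ex_has_greatest_nat[of path "[]" length "Suc k"] by metis
  let ?l = "0 # xs"
  from xs have dist: "distinct (map abs ?l)" and bnd: "abs ` set ?l \<subseteq> {0..int k}"
    and sub: "set (links ?l) \<subseteq> M"
    unfolding path_def by blast+
  have inj: "x = y" if "x \<in> set ?l" "y \<in> set ?l" "\<bar>x\<bar> = \<bar>y\<bar>" for x y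
    using dist that unfolding distinct_map inj_on_def by blast
  define z where "z = last ?l"
  have l: "?l = butlast ?l @ [z]" by (simp add: z_def)
  have "distinct ?l" using dist unfolding distinct_map by blast
  then have z: "z \<in> set ?l" "z \<notin> set (butlast ?l)"
    by (simp add: z_def) (metis \<open>distinct ?l\<close> distinct_append l not_distinct_conv_prefix)
  have "\<bar>z\<bar> \<in> {0..int k}" using z(1) bnd by blast
  then have "exit z \<in> ?V" by (simp add: mem_K_verts_iff)
  then obtain e where e: "e \<in> M" "exit z \<in> e" using M unfolding perfect_matching_def by blast
  obtain w where w: "{exit z, w} \<in> M" "w \<in> ?V" "w \<noteq> exit z"
  proof (rule matching_edgeE[OF M e(1)])
    fix a b assume ab: "e = {a, b}" "a \<in> ?V" "b \<in> ?V" "a \<noteq> b"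
    with e(2) consider "a = exit z" | "b = exit z" by blast
    then show thesis
      using ab e(1) that[of a] that[of b] by cases (auto simp: insert_commute)
  qed
  \<comment> \<open>All vertices of visited pairs other than \<open>entry 0\<close> and \<open>exit z\<close> are already matched.\<close>
  have "w = entry 0"
  proof (cases "fst w \<in> (\<lambda>x. nat \<bar>x\<bar>) ` set ?l")
    case True
    then obtain x where x: "x \<in> set ?l" "w = entry x \<or> w = exit x"
      using vertex_cases by blast
    from x(2) show ?thesis
    proof
      assume wx: "w = entry x"
      show ?thesis
      proof (cases "x = 0")
        case False
        with x(1) have "x \<in> set (tl ?l)" by simp
        then obtain u where u: "u \<in> set (butlast ?l)" "{exit u, entry x} \<in> set (links ?l)"
          by (rule link_into)
        have "exit z = exit u"
          by (rule matching_partner_unique[OF M, of "entry x"])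
            (use u sub w wx in \<open>auto simp: insert_commute\<close>)
        with u z show ?thesis by simp
      qed (use wx in simp)
    next
      assume wx: "w = exit x"
      with w have "x \<noteq> z" by auto
      with x(1) have "x \<in> set (butlast ?l)" by (metis l Un_iff empty_iff empty_set set_ConsD set_append)
      then obtain y where y: "y \<in> set (tl ?l)" "{exit x, entry y} \<in> set (links ?l)"
        by (rule link_from)
      have "exit z = entry y"
        by (rule matching_partner_unique[OF M, of "exit x"])
          (use y sub w wx in \<open>auto simp: insert_commute\<close>)
      then have "y = - z" "z \<noteq> 0" by auto
      with inj[of y z] y(1) z(1) show ?thesis by auto
    qed
  next
    case False
    \<comment> \<open>The \<open>M\<close>-edge at \<open>exit z\<close> leads to a new pair, and the walk was not longest.\<close>
    define y where "y = (if snd w then int (fst w) else - int (fst w))"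
    have absy: "\<bar>y\<bar> = int (fst w)" by (simp add: y_def)
    have new: "\<bar>y\<bar> \<notin> abs ` set ?l"
      using False unfolding absy by (metis (no_types, lifting) image_iff nat_int)
    have "fst w \<noteq> 0" using False by (metis abs_zero image_eqI list.set_intros(1) nat_0)
    then have wy: "w = entry y" by (cases w) (auto simp: entry_def y_def)
    have "path (xs @ [y])"
      unfolding path_def
    proof (intro conjI)
      show "distinct (map abs (0 # xs @ [y]))" using dist new by auto
      show "abs ` set (0 # xs @ [y]) \<subseteq> {0..int k}"
        using bnd w(2) by (auto simp: absy mem_K_verts_iff)
      show "set (links (0 # xs @ [y])) \<subseteq> M"
        using links_append[of ?l "[y]"] sub w(1) wy by (simp add: junction_def z_def)
    qed
    with max show ?thesis by fastforce
  qed
  with w(1) have closed: "set (links (0 # xs @ [0])) \<subseteq> M"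
    using links_append[of ?l "[0]"] sub by (simp add: junction_def z_def)
  define S :: "vertex set" where "S = {v. fst v \<in> (\<lambda>x. nat \<bar>x\<bar>) ` set ?l}"
  have S_M: "u \<in> S \<Longrightarrow> v \<in> S" if uv: "{u, v} \<in> M" for u v
  proof -
    assume "u \<in> S"
    then obtain x where x: "x \<in> set ?l" "u = entry x \<or> u = exit x"
      unfolding S_def using vertex_cases by blast
    then have "x \<in> set (butlast (0 # xs @ [0]))" "x \<in> set (tl (0 # xs @ [0]))"
      by (auto simp: butlast_append)
    then obtain p q where "p \<in> set (tl (0 # xs @ [0]))" "q \<in> set (butlast (0 # xs @ [0]))"
      and pq: "{exit x, entry p} \<in> M" "{exit q, entry x} \<in> M"
      using closed by (meson link_from link_into subsetD)
    then have "p \<in> set ?l" "q \<in> set ?l"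
      by (auto simp: butlast_append split: if_splits)
    from x(2) uv pq have "v = entry p \<or> v = exit q"
      using matching_partner_unique[OF M, of "exit x" v "entry p"]
        matching_partner_unique[OF M, of "entry x" v "exit q"] by (auto simp: insert_commute)
    with \<open>p \<in> set ?l\<close> \<open>q \<in> set ?l\<close> show "v \<in> S" unfolding S_def by (auto simp del: list.set)
  qed
  have "set c \<subseteq> S"
  proof (rule list_closed_set)
    fix i assume "Suc i < length c"
    then have "{c ! i, c ! Suc i} \<in> id_matching (Suc k) \<union> M"
      using consecutive_in_cycle_edges cyc by blast
    then show "c ! i \<in> S \<longleftrightarrow> c ! Suc i \<in> S"
    proof
      assume "{c ! i, c ! Suc i} \<in> id_matching (Suc k)"
      then have "fst (c ! i) = fst (c ! Suc i)"
        by (auto simp: id_matching_def doubleton_eq_iff)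
      then show ?thesis by (simp add: S_def)
    next
      assume "{c ! i, c ! Suc i} \<in> M"
      then show ?thesis using S_M by (metis insert_commute)
    qed
  next
    show "entry 0 \<in> set c" by (simp add: c(1) mem_K_verts_iff)
    show "entry 0 \<in> S" by (simp add: S_def)
  qed
  have "{0..int k} \<subseteq> abs ` set ?l"
  proof
    fix x assume x: "x \<in> {0..int k}"
    then have "(nat x, True) \<in> set c" by (auto simp: c(1) mem_K_verts_iff)
    with \<open>set c \<subseteq> S\<close> have "nat x \<in> (\<lambda>x. nat \<bar>x\<bar>) ` set ?l" by (auto simp: S_def)
    then obtain y where "y \<in> set ?l" "nat x = nat \<bar>y\<bar>" by blast
    with x show "x \<in> abs ` set ?l" by (intro rev_image_eqI[of y]) auto
  qed
  with bnd dist have perm: "xs \<in> signed_perms k"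
    unfolding signed_perms_iff_Cons_0 by blast
  moreover have "matching_of xs = M"
    by (rule matching_subset_eq[OF matching_matching_of[OF perm] M]) (simp add: matching_of_def closed)
  ultimately show ?thesis by blast
qed

section \<open>Reversals are flips\<close>

lemma signed_reversal_iff:
  "(\<exists>i j. 1 \<le> i \<and> i \<le> j \<and> j \<le> length \<sigma> \<and> \<tau> = signed_reversal i j \<sigma>) \<longleftrightarrow>
    (\<exists>xs ys zs. ys \<noteq> [] \<and> \<sigma> = xs @ ys @ zs \<and> \<tau> = xs @ map uminus (rev ys) @ zs)"
proof
  assume "\<exists>i j. 1 \<le> i \<and> i \<le> j \<and> j \<le> length \<sigma> \<and> \<tau> = signed_reversal i j \<sigma>"
  then obtain i j where *: "1 \<le> i" "i \<le> j" "j \<le> length \<sigma>" "\<tau> = signed_reversal i j \<sigma>" by blast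
  let ?ys = "drop (i - 1) (take j \<sigma>)"
  have "?ys \<noteq> []" using * by simp
  moreover have "\<sigma> = take (i - 1) \<sigma> @ ?ys @ drop j \<sigma>"
  proof -
    have "take (i - 1) \<sigma> = take (i - 1) (take j \<sigma>)" using * by (simp add: min_absorb1)
    then show ?thesis by (simp only: append_take_drop_id flip: append_assoc)
  qed
  ultimately show "\<exists>xs ys zs. ys \<noteq> [] \<and> \<sigma> = xs @ ys @ zs \<and> \<tau> = xs @ map uminus (rev ys) @ zs"
    using *(4) unfolding signed_reversal_def by blast
next
  assume "\<exists>xs ys zs. ys \<noteq> [] \<and> \<sigma> = xs @ ys @ zs \<and> \<tau> = xs @ map uminus (rev ys) @ zs"
  then obtain xs ys zs where *: "ys \<noteq> []" "\<sigma> = xs @ ys @ zs" "\<tau> = xs @ map uminus (rev ys) @ zs"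
    by blast
  have "Suc (length xs) \<le> length xs + length ys" using *(1) by (cases ys) auto
  moreover have "\<tau> = signed_reversal (Suc (length xs)) (length xs + length ys) \<sigma>"
    using * by (simp add: signed_reversal_def)
  ultimately show "\<exists>i j. 1 \<le> i \<and> i \<le> j \<and> j \<le> length \<sigma> \<and> \<tau> = signed_reversal i j \<sigma>"
    using *(2) by (intro exI[of _ "Suc (length xs)"] exI[of _ "length xs + length ys"]) auto
qed

text \<open>
  The reversed segment is entered at what was its last exit and left at what was its first entry:
  the label \<open>- last ys\<close> now comes first and \<open>- hd ys\<close> comes last.
\<close>

lemma links_segment_reversal:
  assumes "xs \<noteq> []" "ys \<noteq> []" "zs \<noteq> []" "0 \<notin> set ys"
  shows "set (links (xs @ map uminus (rev ys) @ zs)) =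
    set (links xs) \<union> set (links ys) \<union> set (links zs) \<union>
    {{exit (last xs), exit (last ys)}, {entry (hd ys), entry (hd zs)}}"
proof -
  have "last ys \<noteq> 0" "hd ys \<noteq> 0" using assms by (metis last_in_set, metis hd_in_set)
  then have "junction xs (map uminus (rev ys) @ zs) = {exit (last xs), exit (last ys)}"
    "junction (map uminus (rev ys)) zs = {entry (hd ys), entry (hd zs)}"
    using assms
    by (auto simp: junction_def hd_append hd_map hd_rev last_map last_rev entry_uminus exit_uminus)
  then show ?thesis
    using assms by (auto simp: links_append links_map_uminus_rev)
qed

lemma matching_of_remove_junctions:
  assumes "\<sigma> \<in> signed_perms k" "0 # \<sigma> @ [0] = xs @ ys @ zs" "xs \<noteq> []" "ys \<noteq> []" "zs \<noteq> []"
  shows "matching_of \<sigma> - {junction xs ys, junction ys zs} =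
    set (links xs) \<union> set (links ys) \<union> set (links zs)"
    and "junction xs ys \<in> matching_of \<sigma>" "junction ys zs \<in> matching_of \<sigma>"
    and "junction xs ys \<noteq> junction ys zs"
proof -
  have eq: "links (0 # \<sigma> @ [0]) =
      links xs @ junction xs ys # links ys @ junction ys zs # links zs"
    unfolding assms(2) using assms(3-) links_append[of xs "ys @ zs"]
    by (simp add: links_append junction_def)
  with distinct_links[OF assms(1)] have d:
    "distinct (links xs @ junction xs ys # links ys @ junction ys zs # links zs)" by simp
  show "matching_of \<sigma> - {junction xs ys, junction ys zs} =
    set (links xs) \<union> set (links ys) \<union> set (links zs)"
    using d unfolding matching_of_def eq by auto
  show "junction xs ys \<in> matching_of \<sigma>" "junction ys zs \<in> matching_of \<sigma>"
    unfolding matching_of_def eq by auto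
  show "junction xs ys \<noteq> junction ys zs" using d by auto
qed

lemma flip_adjacent_reversal:
  assumes "\<sigma> \<in> signed_perms k" "\<tau> \<in> signed_perms k"
    and "ys \<noteq> []" "\<sigma> = xs @ ys @ zs" "\<tau> = xs @ map uminus (rev ys) @ zs"
  shows "flip_adjacent (matching_of \<sigma>) (matching_of \<tau>)"
proof -
  let ?p = "exit (last (0 # xs))" and ?u = "entry (hd ys)"
    and ?v = "exit (last ys)" and ?q = "entry (hd (zs @ [0]))"
  have split: "0 # \<sigma> @ [0] = (0 # xs) @ ys @ (zs @ [0])" using assms(4) by simp
  have junctions: "junction (0 # xs) ys = {?p, ?u}" "junction ys (zs @ [0]) = {?v, ?q}"
    by (simp_all only: junction_def)
  have ends: "0 # xs \<noteq> []" "zs @ [0] \<noteq> []" by simp_all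
  note rem = matching_of_remove_junctions[OF assms(1) split ends(1) assms(3) ends(2),
    unfolded junctions]
  note M = matching_matching_of[OF assms(1)]
  have "0 \<notin> set ys" using signed_perm_0_notin[OF assms(1)] assms(4) by simp
  have "matching_of \<tau> = set (links ((0 # xs) @ map uminus (rev ys) @ (zs @ [0])))"
    by (simp add: matching_of_def assms(5))
  also have "\<dots> = matching_of \<sigma> - {{?p, ?u}, {?v, ?q}} \<union> {{?p, ?v}, {?u, ?q}}"
    unfolding rem(1) by (rule links_segment_reversal) (use assms(3) \<open>0 \<notin> set ys\<close> in simp_all)
  finally have "matching_of \<tau> = matching_of \<sigma> - {{?u, ?p}, {?v, ?q}} \<union> {{?p, ?v}, {?q, ?u}}"
    by (simp only: insert_commute)
  moreover have "{?u, ?p} \<in> matching_of \<sigma>" using rem(2) by (simp only: insert_commute)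
  moreover have "distinct [?u, ?p, ?v, ?q]"
  proof -
    have "?p \<noteq> ?u" "?v \<noteq> ?q"
      using matching_edge_neq[OF M] rem(2,3) by blast+
    moreover have "{?p, ?u} \<inter> {?v, ?q} = {}"
      using matching_unique[OF M rem(2,3)] rem(4) by blast
    ultimately show ?thesis by simp
  qed
  ultimately show ?thesis
    unfolding matching_flip_adjacent_iff[OF M matching_matching_of[OF assms(2)] finite_K]
    using rem(3) by blast
qed

text \<open>
  Of the two new ways to match the ends of the removed links, one gives the links of a reversed
  segment. The other leaves all the links of the walk without the middle segment, so
  the walk of \<open>\<tau>\<close> would be shorter than that of \<open>\<sigma>\<close>.
\<close>

lemma reversal_of_flip_adjacent:
  assumes "\<sigma> \<in> signed_perms k" "\<tau> \<in> signed_perms k"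
    and "flip_adjacent (matching_of \<sigma>) (matching_of \<tau>)"
  shows "\<exists>xs ys zs. ys \<noteq> [] \<and> \<sigma> = xs @ ys @ zs \<and> \<tau> = xs @ map uminus (rev ys) @ zs"
proof -
  let ?M = "matching_of \<sigma>" and ?N = "matching_of \<tau>"
  \<comment> \<open>Being symmetric, this holds for the two links in the order in which they lie on the walk.\<close>
  define switches where "switches e e' \<longleftrightarrow> (\<exists>a b c d. {a, b} = e \<and> {c, d} = e' \<and>
    ?N = ?M - {e, e'} \<union> {{b, c}, {d, a}})" for e e'
  have switches_sym: "switches e' e" if "switches e e'" for e e'
  proof -
    from that obtain a b c d where "{a, b} = e" "{c, d} = e'"
      "?N = ?M - {e, e'} \<union> {{b, c}, {d, a}}"
      unfolding switches_def by (elim exE conjE)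
    moreover from this(3) have "?N = ?M - {e', e} \<union> {{d, a}, {b, c}}"
      by (simp only: insert_commute)
    ultimately show ?thesis
      unfolding switches_def by (intro exI[of _ c] exI[of _ d] exI[of _ a] exI[of _ b] conjI)
  qed
  obtain a b c d where *: "distinct [a, b, c, d]" "{a, b} \<in> ?M" "{c, d} \<in> ?M"
    "?N = ?M - {{a, b}, {c, d}} \<union> {{b, c}, {d, a}}"
    using assms(3)
    unfolding matching_flip_adjacent_iff[OF assms(1,2)[THEN matching_matching_of] finite_K]
    by (elim exE conjE)
  have sw: "switches {a, b} {c, d}"
    unfolding switches_def by (rule exI[of _ a], rule exI[of _ b], rule exI[of _ c],
        rule exI[of _ d], simp only: *(4) simp_thms)
  have "{a, b} \<noteq> {c, d}" using *(1) by (auto simp: doubleton_eq_iff)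
  with *(2,3) obtain as bs cs where ne: "as \<noteq> []" "bs \<noteq> []" "cs \<noteq> []"
    and split: "0 # \<sigma> @ [0] = as @ bs @ cs"
    and junctions: "{a, b} = junction as bs \<and> {c, d} = junction bs cs \<or>
      {c, d} = junction as bs \<and> {a, b} = junction bs cs"
    unfolding matching_of_def by (rule two_links_split)
  from junctions sw have sw: "switches (junction as bs) (junction bs cs)"
    using switches_sym by auto
  from split ne(1) obtain xs where xs: "as = 0 # xs" by (cases as) auto
  from split ne(3) obtain zs where zs: "cs = zs @ [0]"
    by (cases cs rule: rev_cases) auto
  have \<sigma>: "\<sigma> = xs @ bs @ zs" using split xs zs by simp
  have no0: "0 \<notin> set xs" "0 \<notin> set bs" "0 \<notin> set zs"
    using signed_perm_0_notin[OF assms(1)] \<sigma> by auto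
  let ?p = "exit (last as)" and ?u = "entry (hd bs)" and ?v = "exit (last bs)" and ?q = "entry (hd cs)"
  from sw obtain a b c d where abcd: "{a, b} = {?p, ?u}" "{c, d} = {?v, ?q}"
    "?N = ?M - {junction as bs, junction bs cs} \<union> {{b, c}, {d, a}}"
    unfolding switches_def by (elim exE conjE) (simp only: junction_def)
  have N: "?N = set (links as) \<union> set (links bs) \<union> set (links cs) \<union> {{b, c}, {d, a}}"
    using abcd(3) matching_of_remove_junctions(1)[OF assms(1) split ne] by simp
  have "{{b, c}, {d, a}} = {{?p, ?v}, {?u, ?q}} \<or> {{b, c}, {d, a}} = {{?p, ?q}, {?u, ?v}}"
  proof -
    have "a = ?p \<and> b = ?u \<or> a = ?u \<and> b = ?p" "c = ?v \<and> d = ?q \<or> c = ?q \<and> d = ?v"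
      using abcd(1,2) by (simp_all only: doubleton_eq_iff)
    then show ?thesis by (elim disjE conjE) (simp_all only: insert_commute simp_thms)
  qed
  then show ?thesis
  proof
    assume "{{b, c}, {d, a}} = {{?p, ?v}, {?u, ?q}}"
    with N have "?N = set (links (as @ map uminus (rev bs) @ cs))"
      using links_segment_reversal[OF ne no0(2)] by simp
    then have "xs @ map uminus (rev bs) @ zs = \<tau>"
      by (intro matching_of_determines[OF assms(2)]) (use no0 in \<open>auto simp: xs zs\<close>)
    with \<sigma> ne(2) show ?thesis
      by (intro exI[of _ xs] exI[of _ bs] exI[of _ zs]) simp
  next
    assume "{{b, c}, {d, a}} = {{?p, ?q}, {?u, ?v}}"
    with N have "set (links (as @ cs)) \<subseteq> ?N"
      using ne by (auto simp: links_append junction_def)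
    then have \<tau>: "xs @ zs = \<tau>"
      by (intro matching_of_determines[OF assms(2)]) (use no0 in \<open>auto simp: xs zs\<close>)
    have "length (xs @ zs) = k" "length \<sigma> = k"
      using length_signed_perm[OF assms(2)] length_signed_perm[OF assms(1)] by (simp_all only: \<tau>)
    then have "length bs = 0" unfolding \<sigma> length_append by linarith
    with ne(2) show ?thesis by simp
  qed
qed

section \<open>The isomorphism\<close>

lemma digraph_iso_pairI:
  fixes G :: "('a, 'a \<times> 'a) pre_digraph" and H :: "('b, 'b \<times> 'b) pre_digraph"
  assumes G: "wf_digraph G" "tail G = fst" "head G = snd"
    and H: "wf_digraph H" "tail H = fst" "head H = snd"
    and f: "bij_betw f (verts G) (verts H)"
    and arcs: "\<And>u v. u \<in> verts G \<Longrightarrow> v \<in> verts G \<Longrightarrow> (u, v) \<in> arcs G \<longleftrightarrow> (f u, f v) \<in> arcs H"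
  shows "digraph_iso G H"
proof -
  let ?h = "\<lparr>iso_verts = f, iso_arcs = map_prod f f, iso_head = snd, iso_tail = fst\<rparr>"
  have inG: "u \<in> verts G \<and> v \<in> verts G" if "(u, v) \<in> arcs G" for u v
    using wf_digraph.tail_in_verts[OF G(1) that] wf_digraph.head_in_verts[OF G(1) that] G(2,3) by simp
  have inH: "u \<in> verts H \<and> v \<in> verts H" if "(u, v) \<in> arcs H" for u v
    using wf_digraph.tail_in_verts[OF H(1) that] wf_digraph.head_in_verts[OF H(1) that] H(2,3) by simp
  have inj: "inj_on f (verts G)" and img: "f ` verts G = verts H"
    using f by (auto simp: bij_betw_def)
  have "inj_on (map_prod f f) (arcs G)"
    by (rule inj_on_subset[OF map_prod_inj_on[OF inj inj]]) (use inG in auto)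
  then have "pre_digraph.digraph_isomorphism G ?h"
    using G inj by (auto simp: pre_digraph.digraph_isomorphism_def)
  moreover have "map_prod f f ` arcs G = arcs H"
  proof
    show "map_prod f f ` arcs G \<subseteq> arcs H" using inG arcs by auto
    show "arcs H \<subseteq> map_prod f f ` arcs G"
    proof
      fix a assume a: "a \<in> arcs H"
      then have "fst a \<in> f ` verts G" "snd a \<in> f ` verts G"
        using inH[of "fst a" "snd a"] img by auto
      then obtain u v where uv: "u \<in> verts G" "v \<in> verts G" "a = (f u, f v)"
        by (metis imageE prod.collapse)
      with a arcs have "(u, v) \<in> arcs G" by blast
      with uv(3) show "a \<in> map_prod f f ` arcs G" by force
    qed
  qed
  with img H have "H = app_iso ?h G"
    by (intro pre_digraph.equality) (auto simp: app_iso_def)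
  ultimately show ?thesis unfolding digraph_iso_def by blast
qed

theorem proposition3p3:
  fixes n :: nat
  assumes "n \<ge> 2"
  shows "digraph_iso
    (with_proj (flip_graph_K n) \<restriction> {M \<in> pverts (flip_graph_K n). has_type n M [n]})
    (with_proj (SR (n - 1)))"
proof -
  define k where "k = n - 1"
  with assms have n: "n = Suc k" by simp
  let ?S = "{M \<in> pverts (flip_graph_K n). has_type n M [n]}"
  let ?G = "with_proj (flip_graph_K n) \<restriction> ?S" and ?H = "with_proj (SR k)"
  have G: "wf_digraph ?G"
  proof -
    interpret pair_graph "flip_graph_K n" by (rule pair_graph_flip_graph_K)
    show ?thesis by (rule wellformed_induce_subgraph)
  qed
  have H: "wf_digraph ?H"
  proof -
    interpret pair_graph "SR k" by (rule pair_graph_SR)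
    show ?thesis by unfold_locales
  qed
  have mem: "matching_of \<sigma> \<in> ?S" if "\<sigma> \<in> signed_perms k" for \<sigma>
    using matching_matching_of[OF that] has_type_matching_of[OF that]
    by (simp add: n flip_graph_K_def flip_graph_def)
  have "bij_betw matching_of (signed_perms k) ?S"
  proof (rule bij_betw_imageI[OF inj_on_matching_of])
    show "matching_of ` signed_perms k = ?S"
      using mem matching_of_surj by (auto simp: n flip_graph_K_def flip_graph_def)
  qed
  then have bij: "bij_betw matching_of (verts ?H) (verts ?G)" by (simp add: SR_def)
  have "digraph_iso ?H ?G"
  proof (rule digraph_iso_pairI[OF H _ _ G _ _ bij])
    fix \<sigma> \<tau> assume "\<sigma> \<in> verts ?H" "\<tau> \<in> verts ?H"
    then have \<sigma>\<tau>: "\<sigma> \<in> signed_perms k" "\<tau> \<in> signed_perms k" by (simp_all add: SR_def)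
    have "(\<sigma>, \<tau>) \<in> arcs ?H \<longleftrightarrow>
        (\<exists>i j. 1 \<le> i \<and> i \<le> j \<and> j \<le> length \<sigma> \<and> \<tau> = signed_reversal i j \<sigma>)"
      using \<sigma>\<tau> by (simp add: SR_def length_signed_perm)
    also have "\<dots> \<longleftrightarrow> flip_adjacent (matching_of \<sigma>) (matching_of \<tau>)"
      unfolding signed_reversal_iff
      using flip_adjacent_reversal[OF \<sigma>\<tau>] reversal_of_flip_adjacent[OF \<sigma>\<tau>] by blast
    also have "\<dots> \<longleftrightarrow> (matching_of \<sigma>, matching_of \<tau>) \<in> arcs ?G"
      using mem[OF \<sigma>\<tau>(1)] mem[OF \<sigma>\<tau>(2)] by (simp add: flip_graph_K_def flip_graph_def)
    finally show "(\<sigma>, \<tau>) \<in> arcs ?H \<longleftrightarrow> (matching_of \<sigma>, matching_of \<tau>) \<in> arcs ?G" .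
  qed simp_all
  then have "digraph_iso ?G ?H"
    by (rule digraph_iso_swap[OF H])
  then show ?thesis by (simp add: k_def)
qed

end
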